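(* Let the braid group $B_4$ act on $\mathbb{P}^2(\mathbb{Q})$ through the integral reduced Burau representation $\rho$. (i) The rational projective plane is decomposed into infinitely many $B_4$-orbits as the disjoint union $$\mathbb{P}^2(\mathbb{Q}) = \{[1:0:1]\}\ \sqcup\ \mathrm{Orb}_{B_4}([0:1:0])\ \sqcup \bigsqcup_{\substack{n\ge 2,\ 0<m\le n/2\\ \gcd(m,n)=1}} \mathrm{Orb}_{B_4}([m:n:m]),$$ where $m,n$ range over integers, the orbits in the union being pairwise distinct. (ii) For every pair $(m,n)$ of coprime integers with $n\geq 1$, the orbit $\mathrm{Orb}_{B_4}([m:n:m])$ consists exactly of the points $$\mathrm{Orb}_{B_4}([m:n:m]) = \left\{[r:s:t]\ \middle|\ \gcd(r-t,s)=n \text{ and } r,t\equiv \pm m \pmod n\right\},$$ where the same sign is taken for $r$ and $t$, and $$\mathrm{Orb}_{B_4}([0:1:0]) = \{[r:s:t]\ |\ \gcd(r-t,s)=1\}.$$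
   Context: $B_4$ is the braid group generated by $\sigma_1,\sigma_2,\sigma_3$ with relations $\sigma_1\sigma_2\sigma_1=\sigma_2\sigma_1\sigma_2$, $\sigma_2\sigma_3\sigma_2=\sigma_3\sigma_2\sigma_3$, $\sigma_1\sigma_3=\sigma_3\sigma_1$. The integral reduced Burau representation is the homomorphism $\rho:B_4\to \mathrm{SL}_3(\mathbb{Z})$ given by $$\rho(\sigma_1)=\begin{pmatrix}1&1&0\\0&1&0\\0&0&1\end{pmatrix},\quad \rho(\sigma_2)=\begin{pmatrix}1&0&0\\-1&1&1\\0&0&1\end{pmatrix},\quad \rho(\sigma_3)=\begin{pmatrix}1&0&0\\0&1&0\\0&-1&1\end{pmatrix}.$$ It acts on $\mathbb{P}^2(\mathbb{Q})$ by matrix multiplication on column vectors of homogeneous coordinates: $\rho(\sigma_1):[r:s:t]\mapsto[r+s:s:t]$, $\rho(\sigma_2):[r:s:t]\mapsto[r:s+t-r:t]$, $\rho(\sigma_3):[r:s:t]\mapsto[r:s:t-s]$. $\mathrm{Orb}_{B_4}(p)$ denotes the orbit of $p$. Every point of $\mathbb{P}^2(\mathbb{Q})$ is written $[r:s:t]$ with $r,s,t\in\mathbb{Z}$ mutually prime (i.e. $\gcd(r,s,t)=1$); such a representative is unique up to a global sign. *)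

theory Defs
  imports "HOL-Analysis.Analysis" "HOL-Algebra.Group_Action" "HOL-Number_Theory.Cong"
begin

section \<open>The braid group on four strands\<close>

datatype braid_gen = Sigma1 | Sigma2 | Sigma3

text \<open>A letter \<open>(g, True)\<close> stands for the generator \<open>g\<close>, and \<open>(g, False)\<close> for its inverse.\<close>

type_synonym braid_word = "(braid_gen \<times> bool) list"

inductive braid_eq :: "braid_word \<Rightarrow> braid_word \<Rightarrow> bool" where
  refl: "braid_eq u u"
| sym: "braid_eq u v \<Longrightarrow> braid_eq v u"
| trans: "braid_eq u v \<Longrightarrow> braid_eq v w \<Longrightarrow> braid_eq u w"
| cong: "braid_eq u v \<Longrightarrow> braid_eq (a @ u @ b) (a @ v @ b)"
| cancel: "braid_eq [(g, e), (g, \<not> e)] []"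
| braid12: "braid_eq [(Sigma1, True), (Sigma2, True), (Sigma1, True)]
                     [(Sigma2, True), (Sigma1, True), (Sigma2, True)]"
| braid23: "braid_eq [(Sigma2, True), (Sigma3, True), (Sigma2, True)]
                     [(Sigma3, True), (Sigma2, True), (Sigma3, True)]"
| comm13: "braid_eq [(Sigma1, True), (Sigma3, True)] [(Sigma3, True), (Sigma1, True)]"

quotient_type braid4 = braid_word / braid_eq
  by (rule equivpI) (auto intro: reflpI sympI transpI braid_eq.intros)

lift_definition braid_one :: braid4 is "[]" .

lift_definition braid_mult :: "braid4 \<Rightarrow> braid4 \<Rightarrow> braid4" is "(@)"
proof -
  fix u u' v v' :: braid_word
  assume "braid_eq u u'" "braid_eq v v'"
  then have "braid_eq ([] @ u @ v) ([] @ u' @ v)" "braid_eq (u' @ v @ []) (u' @ v' @ [])"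
    by (blast intro: braid_eq.cong)+
  then show "braid_eq (u @ v) (u' @ v')"
    by (auto intro: braid_eq.trans)
qed

lift_definition sigma :: "braid_gen \<Rightarrow> braid4" is "\<lambda>g. [(g, True)]" .

definition B4 :: "braid4 monoid" where
  "B4 = \<lparr>carrier = UNIV, mult = braid_mult, one = braid_one\<rparr>"

definition word_inv :: "braid_word \<Rightarrow> braid_word" where
  "word_inv w = rev (map (\<lambda>(g, e). (g, \<not> e)) w)"

lemma braid_eq_word_inv: "braid_eq (word_inv w @ w) []"
proof (induction w)
  case Nil
  then show ?case by (simp add: word_inv_def braid_eq.refl)
next
  case (Cons x w)
  obtain g e where x: "x = (g, e)" by (cases x)
  have "braid_eq (word_inv w @ [(g, \<not> e), (g, \<not> \<not> e)] @ w) (word_inv w @ [] @ w)"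
    by (intro braid_eq.cong braid_eq.cancel)
  then show ?case
    using Cons by (auto simp: x word_inv_def intro: braid_eq.trans)
qed

lemma group_B4: "group B4"
proof (rule groupI)
  fix x assume "x \<in> carrier B4"
  have "\<exists>y. braid_mult y x = braid_one"
    by transfer (blast intro: braid_eq_word_inv)
  then show "\<exists>y\<in>carrier B4. y \<otimes>\<^bsub>B4\<^esub> x = \<one>\<^bsub>B4\<^esub>"
    by (simp add: B4_def)
qed (auto simp: B4_def; transfer; simp add: braid_eq.refl)+

section \<open>The integral reduced Burau representation\<close>

definition SL3Z :: "(int^3^3) monoid" where
  "SL3Z = \<lparr>carrier = {A. det A = 1}, mult = (**), one = mat 1\<rparr>"

fun burau_gen :: "braid_gen \<Rightarrow> int^3^3" where
  "burau_gen Sigma1 = vector [vector [1, 1, 0], vector [0, 1, 0], vector [0, 0, 1]]"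
| "burau_gen Sigma2 = vector [vector [1, 0, 0], vector [-1, 1, 1], vector [0, 0, 1]]"
| "burau_gen Sigma3 = vector [vector [1, 0, 0], vector [0, 1, 0], vector [0, -1, 1]]"

fun burau_word :: "braid_word \<Rightarrow> int^3^3" where
  "burau_word [] = mat 1"
| "burau_word ((g, e) # w) = (if e then burau_gen g else matrix_inv (burau_gen g)) ** burau_word w"

lemma det_burau_gen: "det (burau_gen g) = 1"
  by (cases g) (simp_all add: det_3)

lemma burau_gen_inverse:
  "burau_gen g ** matrix_inv (burau_gen g) = mat 1 \<and> matrix_inv (burau_gen g) ** burau_gen g = mat 1"
proof -
  have "\<exists>A. burau_gen g ** A = mat 1 \<and> A ** burau_gen g = mat 1"
  proof (cases g)
    case Sigma1
    then show ?thesis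
      by (intro exI[of _ "vector [vector [1, -1, 0], vector [0, 1, 0], vector [0, 0, 1]]"])
        (simp add: vec_eq_iff forall_3 matrix_matrix_mult_def mat_def sum_3)
  next
    case Sigma2
    then show ?thesis
      by (intro exI[of _ "vector [vector [1, 0, 0], vector [1, 1, -1], vector [0, 0, 1]]"])
        (simp add: vec_eq_iff forall_3 matrix_matrix_mult_def mat_def sum_3)
  next
    case Sigma3
    then show ?thesis
      by (intro exI[of _ "vector [vector [1, 0, 0], vector [0, 1, 0], vector [0, 1, 1]]"])
        (simp add: vec_eq_iff forall_3 matrix_matrix_mult_def mat_def sum_3)
  qed
  then show ?thesis
    unfolding matrix_inv_def by (rule someI_ex)
qed

lemma burau_word_append: "burau_word (u @ v) = burau_word u ** burau_word v"
  by (induction u rule: burau_word.induct) (auto simp: matrix_mul_assoc)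

lemma burau_word_eq: "braid_eq u v \<Longrightarrow> burau_word u = burau_word v"
proof (induction rule: braid_eq.induct)
  case (cancel g e)
  then show ?case using burau_gen_inverse[of g] by (cases e) auto
qed (simp_all add: burau_word_append,
     simp_all add: vec_eq_iff forall_3 matrix_matrix_mult_def mat_def sum_3)

lift_definition burau :: "braid4 \<Rightarrow> int^3^3" is burau_word
  by (rule burau_word_eq)

lemma burau_sigma: "burau (sigma g) = burau_gen g"
  by transfer simp

lemma burau_mult: "burau (braid_mult x y) = burau x ** burau y"
  by transfer (rule burau_word_append)

lemma burau_one: "burau braid_one = mat 1"
  by transfer simp

lemma det_burau_word: "det (burau_word w) = 1"
proof (induction w rule: burau_word.induct)
  case (2 g e w)
  have "det (burau_gen g) * det (matrix_inv (burau_gen g)) = 1"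
    by (metis burau_gen_inverse det_mul det_I)
  then show ?case using 2 by (simp add: det_mul det_burau_gen)
qed simp

lemma det_burau: "det (burau x) = 1"
  by transfer (rule det_burau_word)

lemma burau_hom: "burau \<in> hom B4 SL3Z"
  by (simp add: hom_def B4_def SL3Z_def det_burau burau_mult)

section \<open>The rational projective plane and the action\<close>

definition proportional :: "rat^3 \<Rightarrow> rat^3 \<Rightarrow> bool" where
  "proportional u v \<longleftrightarrow> u \<noteq> 0 \<and> v \<noteq> 0 \<and> (\<exists>c. v = c *s u)"

quotient_type proj_plane = "rat^3" / partial: proportional
proof (rule part_equivpI)
  show "\<exists>x. proportional x x"
    by (rule exI[of _ "axis 1 1"], simp add: proportional_def axis_eq_0_iff, rule exI[of _ 1], simp)
  show "symp proportional"
  proof (rule sympI)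
    fix u v assume "proportional u v"
    then obtain c where *: "u \<noteq> 0" "v \<noteq> 0" "v = c *s u" by (auto simp: proportional_def)
    then have "u = inverse c *s v" by (auto simp: vector_smult_assoc)
    with * show "proportional v u" unfolding proportional_def by blast
  qed
  show "transp proportional"
    by (rule transpI) (auto simp: proportional_def vector_smult_assoc)
qed

text \<open>The point \<open>[r:s:t]\<close>; meaningful only if \<open>r\<close>, \<open>s\<close>, \<open>t\<close> are not all zero.\<close>

definition hpoint :: "int \<Rightarrow> int \<Rightarrow> int \<Rightarrow> proj_plane" where
  "hpoint r s t = abs_proj_plane (vector [of_int r, of_int s, of_int t])"

lemma map_matrix_of_int_mult:
  "map_matrix rat_of_int (A ** B) = map_matrix rat_of_int A ** map_matrix rat_of_int B"
  for A B :: "int^3^3"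
  by (simp add: vec_eq_iff matrix_matrix_mult_def)

lemma map_matrix_of_int_mat1: "map_matrix rat_of_int (mat 1 :: int^3^3) = mat 1"
  by (simp add: vec_eq_iff mat_def)

lemma burau_inverse: "\<exists>y. burau y ** burau x = mat 1"
proof -
  interpret group B4 by (rule group_B4)
  have "\<exists>y. braid_mult y x = braid_one"
    using l_inv_ex[of x] by (auto simp: B4_def)
  then show ?thesis by (metis burau_mult burau_one)
qed

lift_definition burau_act :: "braid4 \<Rightarrow> proj_plane \<Rightarrow> proj_plane"
  is "\<lambda>x v. map_matrix of_int (burau x) *v v"
proof -
  fix x :: braid4 and u v :: "rat^3"
  assume *: "proportional u v"
  let ?M = "map_matrix rat_of_int (burau x)"
  obtain y where "burau y ** burau x = mat 1" using burau_inverse by blast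
  then have "map_matrix of_int (burau y) ** ?M = mat 1"
    by (metis map_matrix_of_int_mult map_matrix_of_int_mat1)
  then have "map_matrix of_int (burau y) *v (?M *v w) = w" for w
    by (simp add: matrix_vector_mul_assoc)
  then have "?M *v w \<noteq> 0" if "w \<noteq> 0" for w
    using that by (metis matrix_vector_mult_0_right)
  moreover have "?M *v (c *s w) = c *s (?M *v w)" for c w
    by (rule vector_scalar_commute)
  ultimately show "proportional (?M *v u) (?M *v v)"
    using * by (auto simp: proportional_def)
qed

lemma burau_act_mult: "burau_act (braid_mult x y) p = burau_act x (burau_act y p)"
proof -
  obtain v where v: "proportional v v" "p = abs_proj_plane v"
    by (metis Quotient3_abs_rep Quotient3_rep_reflp Quotient3_proj_plane)
  have act: "burau_act z (abs_proj_plane w) = abs_proj_plane (map_matrix of_int (burau z) *v w)"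
    if "proportional w w" for z w
    using burau_act.abs_eq that by (simp add: eq_onp_def)
  have "proportional (map_matrix of_int (burau y) *v v) (map_matrix of_int (burau y) *v v)"
    using burau_act.rsp v by (auto simp: rel_fun_def)
  then show ?thesis
    using v by (simp add: act burau_mult map_matrix_of_int_mult matrix_vector_mul_assoc)
qed

lemma burau_act_one: "burau_act braid_one p = p"
  by transfer (simp add: burau_one map_matrix_of_int_mat1)

lemma group_action_burau: "group_action B4 UNIV burau_act"
proof -
  interpret group B4 by (rule group_B4)
  have "bij (burau_act x)" for x
  proof -
    have "braid_mult (inv\<^bsub>B4\<^esub> x) x = braid_one" "braid_mult x (inv\<^bsub>B4\<^esub> x) = braid_one"
      using l_inv[of x] r_inv[of x] by (simp_all add: B4_def)
    then have "burau_act (inv\<^bsub>B4\<^esub> x) (burau_act x p) = p"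
      "burau_act x (burau_act (inv\<^bsub>B4\<^esub> x) p) = p" for p
      by (metis burau_act_mult burau_act_one)+
    then show ?thesis by (intro o_bij[of "burau_act (inv\<^bsub>B4\<^esub> x)"]) auto
  qed
  then show ?thesis
    unfolding group_action_def group_hom_def group_hom_axioms_def
    using group_B4 group_BijGroup[of "UNIV :: proj_plane set"]
    by (auto simp: hom_def BijGroup_def Bij_def B4_def compose_def burau_act_mult fun_eq_iff)
qed

lemma burau_act_hpoint:
  assumes "(r, s, t) \<noteq> (0, 0, 0)"
  shows "burau_act (sigma Sigma1) (hpoint r s t) = hpoint (r + s) s t"
    and "burau_act (sigma Sigma2) (hpoint r s t) = hpoint r (s + t - r) t"
    and "burau_act (sigma Sigma3) (hpoint r s t) = hpoint r s (t - s)"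
proof -
  let ?v = "vector [of_int r, of_int s, of_int t] :: rat^3"
  have "?v \<noteq> 0" using assms by (auto simp: vec_eq_iff forall_3)
  then have "proportional ?v ?v"
    by (auto simp: proportional_def intro: exI[of _ 1])
  then have *: "burau_act z (hpoint r s t) = abs_proj_plane (map_matrix of_int (burau z) *v ?v)" for z
    using burau_act.abs_eq by (simp add: eq_onp_def hpoint_def)
  show "burau_act (sigma Sigma1) (hpoint r s t) = hpoint (r + s) s t"
    "burau_act (sigma Sigma2) (hpoint r s t) = hpoint r (s + t - r) t"
    "burau_act (sigma Sigma3) (hpoint r s t) = hpoint r s (t - s)"
    unfolding * burau_sigma
    by (auto simp: hpoint_def vec_eq_iff forall_3 matrix_vector_mult_def sum_3
        intro!: arg_cong[of _ _ abs_proj_plane])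
qed

abbreviation Orb :: "proj_plane \<Rightarrow> proj_plane set" where
  "Orb p \<equiv> orbit B4 burau_act p"

definition orbit_indices :: "(int \<times> int) set" where
  "orbit_indices = {(m, n). n \<ge> 2 \<and> 0 < m \<and> 2 * m \<le> n \<and> coprime m n}"

end

theory Submission
  imports Defs
begin

text \<open>
  In the coordinates \<open>d = r - t\<close>, \<open>s\<close>, \<open>t\<close>, the generators \<open>\<sigma>\<^sub>1\<close> and \<open>\<sigma>\<^sub>2\<close> fix \<open>t\<close> and act on \<open>(d, s)\<close>
  by the two shears generating \<open>SL\<^sub>2(\<int>)\<close>, while \<open>\<sigma>\<^sub>3\<close> acts on \<open>(d, s)\<close> like \<open>\<sigma>\<^sub>1\<close> and changes
  \<open>t\<close> by \<open>s\<close>. Hence \<open>n = gcd(d, s)\<close> and the common residue of \<open>r\<close> and \<open>t\<close> modulo \<open>n\<close> are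
  invariants, up to the sign of the representative. Conversely, the Euclidean algorithm moves
  \<open>[r:s:t]\<close> to \<open>[t:n:t]\<close>, and \<open>\<sigma>\<^sub>3\<^sup>-\<^sup>1\<sigma>\<^sub>1\<close> shifts \<open>[t:n:t]\<close> to \<open>[t+n:n:t+n]\<close>.
\<close>

section \<open>Primitive coordinates and equality of rational projective points\<close>

definition primitive :: "int \<Rightarrow> int \<Rightarrow> int \<Rightarrow> bool" where
  "primitive r s t \<longleftrightarrow> gcd r (gcd s t) = 1"

definition burau_class :: "int \<Rightarrow> int \<Rightarrow> proj_plane set" where
  "burau_class m n = {hpoint r s t | r s t. gcd r (gcd s t) = 1 \<and> gcd (r - t) s = n \<and>
     (([r = m] (mod n) \<and> [t = m] (mod n)) \<or> ([r = - m] (mod n) \<and> [t = - m] (mod n)))}"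

lemma primitive_nonzero: "primitive r s t \<Longrightarrow> (r, s, t) \<noteq> (0, 0, 0)"
  by (auto simp: primitive_def)

lemma proportional_refl: "v \<noteq> 0 \<Longrightarrow> proportional v v"
  by (auto simp: proportional_def intro: exI[of _ 1])

lemma vector_of_int_nonzero:
  "(r, s, t) \<noteq> (0, 0, 0) \<Longrightarrow> (vector [of_int r, of_int s, of_int t] :: rat^3) \<noteq> 0"
  by (auto simp: vec_eq_iff forall_3)

lemma abs_proj_plane_eq_iff:
  assumes "u \<noteq> 0" "v \<noteq> 0"
  shows "abs_proj_plane u = abs_proj_plane v \<longleftrightarrow> proportional u v"
  using Quotient3_rel[OF Quotient3_proj_plane, of u v] assms by (simp add: proportional_refl)

lemma hpoint_smult:
  assumes "c \<noteq> 0" "(r, s, t) \<noteq> (0, 0, 0)"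
  shows "hpoint (c * r) (c * s) (c * t) = hpoint r s t"
proof -
  let ?v = "vector [of_int r, of_int s, of_int t] :: rat^3"
  have "vector [of_int (c * r), of_int (c * s), of_int (c * t)] = rat_of_int c *s ?v"
    by (simp add: vec_eq_iff forall_3)
  moreover have "?v \<noteq> 0"
    using assms(2) by (rule vector_of_int_nonzero)
  ultimately show ?thesis
    using assms(1) unfolding hpoint_def
    by (subst eq_commute, subst abs_proj_plane_eq_iff) (auto simp: proportional_def)
qed

lemma hpoint_uminus:
  "(r, s, t) \<noteq> (0, 0, 0) \<Longrightarrow> hpoint (- r) (- s) (- t) = hpoint r s t"
  using hpoint_smult[of "-1" r s t] by simp

lemma gcd3_mult_left: "gcd (c * x) (gcd (c * y) (c * z)) = \<bar>c\<bar> * gcd x (gcd y z)"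
  for c x y z :: int
proof -
  have "gcd (c * x) (gcd (c * y) (c * z)) = gcd (c * x) \<bar>c * gcd y z\<bar>"
    by (simp add: gcd_mult_left abs_mult)
  also have "\<dots> = gcd (c * x) (c * gcd y z)"
    by (rule gcd_abs2_int)
  finally show ?thesis
    by (simp add: gcd_mult_left abs_mult)
qed

text \<open>Clearing the denominator of the proportionality factor \<open>a / b\<close> gives
  \<open>b * v' = a * v\<close> coordinatewise. Comparing the gcds of the coordinates, 1 for both
  primitive triples, leaves |a| = |b|.\<close>

lemma hpoint_primitive_eqD:
  assumes eq: "hpoint r s t = hpoint r' s' t'"
    and prim: "primitive r s t" "primitive r' s' t'"
  shows "(r', s', t') = (r, s, t) \<or> (r', s', t') = (- r, - s, - t)"
proof -
  let ?v = "\<lambda>r s t. vector [of_int r, of_int s, of_int t] :: rat^3"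
  have "proportional (?v r s t) (?v r' s' t')"
    using eq prim unfolding hpoint_def
    by (subst (asm) abs_proj_plane_eq_iff) (auto intro!: vector_of_int_nonzero dest: primitive_nonzero)
  then obtain c where c: "?v r' s' t' = c *s ?v r s t"
    by (auto simp: proportional_def)
  obtain a b where ab: "quotient_of c = (a, b)" by force
  have b: "b > 0" using ab by (rule quotient_of_denom_pos)
  have "of_int r' = c * of_int r" "of_int s' = c * of_int s" "of_int t' = c * of_int t"
    using c by (auto simp: vec_eq_iff forall_3)
  moreover have "c = of_int a / of_int b"
    using ab by (rule quotient_of_div)
  ultimately have "rat_of_int (b * r') = of_int (a * r)" "rat_of_int (b * s') = of_int (a * s)"
    "rat_of_int (b * t') = of_int (a * t)"
    using b by simp_all
  then have *: "b * r' = a * r" "b * s' = a * s" "b * t' = a * t"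
    by (simp_all only: of_int_eq_iff)
  then have "gcd (b * r') (gcd (b * s') (b * t')) = gcd (a * r) (gcd (a * s) (a * t))"
    by simp
  then have "\<bar>b\<bar> = \<bar>a\<bar>"
    using prim by (simp only: gcd3_mult_left primitive_def mult_1_right)
  then consider "a = b" | "a = - b" by linarith
  then show ?thesis
  proof cases
    case 1
    then show ?thesis using * b by simp
  next
    case 2
    then have "b * r' = b * - r" "b * s' = b * - s" "b * t' = b * - t"
      using * by simp_all
    then show ?thesis using b by (simp only: mult_cancel_left) simp
  qed
qed

text \<open>Multiplying by the product of the three denominators gives integer coordinates; dividing
  these by their gcd makes them primitive.\<close>

lemma ex_primitive_hpoint: "\<exists>r s t. primitive r s t \<and> p = hpoint r s t"
proof -
  obtain v where v: "proportional v v" "p = abs_proj_plane v"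
    by (metis Quotient3_abs_rep Quotient3_rep_reflp Quotient3_proj_plane)
  obtain a b where 1: "quotient_of (v $ 1) = (a, b)" by force
  obtain a' b' where 2: "quotient_of (v $ 2) = (a', b')" by force
  obtain a'' b'' where 3: "quotient_of (v $ 3) = (a'', b'')" by force
  have pos: "b > 0" "b' > 0" "b'' > 0"
    using 1 2 3 by (auto dest: quotient_of_denom_pos)
  have div: "v $ 1 = of_int a / of_int b" "v $ 2 = of_int a' / of_int b'"
    "v $ 3 = of_int a'' / of_int b''"
    using 1 2 3 by (auto dest: quotient_of_div)
  define x y z where "x = a * b' * b''" and "y = a' * b * b''" and "z = a'' * b * b'"
  have eq: "vector [of_int x, of_int y, of_int z] = rat_of_int (b * b' * b'') *s v"
    using pos by (auto simp: vec_eq_iff forall_3 div x_def y_def z_def)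
  have "v \<noteq> 0" using v(1) by (auto simp: proportional_def)
  then have "rat_of_int (b * b' * b'') *s v \<noteq> 0"
    using pos by auto
  then have nz: "(x, y, z) \<noteq> (0, 0, 0)"
    unfolding eq[symmetric] by (auto simp: vec_eq_iff forall_3)
  have p: "p = hpoint x y z"
    unfolding hpoint_def v(2) eq using \<open>v \<noteq> 0\<close> \<open>_ *s v \<noteq> 0\<close>
    by (subst abs_proj_plane_eq_iff) (auto simp: proportional_def)
  define g where "g = gcd x (gcd y z)"
  have g: "g > 0" using nz by (auto simp: g_def intro: le_neq_trans)
  have dvd: "g dvd x" "g dvd y" "g dvd z"
    by (auto simp: g_def intro: gcd_dvd2 dvd_trans[OF gcd_dvd2])
  then obtain r s t where rst: "x = g * r" "y = g * s" "z = g * t" by (auto elim!: dvdE)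
  have "\<bar>g\<bar> * gcd r (gcd s t) = g"
    using gcd3_mult_left[of g r s t, symmetric] unfolding rst[symmetric] g_def[symmetric] .
  then have "primitive r s t"
    using g by (simp add: primitive_def)
  moreover have "p = hpoint r s t"
    unfolding p rst using g nz rst by (intro hpoint_smult) auto
  ultimately show ?thesis by blast
qed

text \<open>In this form primitivity is carried along a generator by cancelling divisible
  summands.\<close>

lemma primitive_iff_common_dvd_unit: "primitive r s t \<longleftrightarrow> (\<forall>d. d dvd r \<longrightarrow> d dvd s \<longrightarrow> d dvd t \<longrightarrow> is_unit d)"
proof
  assume "primitive r s t"
  then show "\<forall>d. d dvd r \<longrightarrow> d dvd s \<longrightarrow> d dvd t \<longrightarrow> is_unit d"
    unfolding primitive_def by (metis gcd_greatest)
next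
  assume *: "\<forall>d. d dvd r \<longrightarrow> d dvd s \<longrightarrow> d dvd t \<longrightarrow> is_unit d"
  have "is_unit (gcd r (gcd s t))"
    by (rule *[rule_format]) (auto intro: dvd_trans[OF gcd_dvd2])
  then show "primitive r s t" by (simp add: primitive_def)
qed

section \<open>Orbits and the action of generators\<close>

interpretation burau: group_action B4 UNIV burau_act
  by (rule group_action_burau)

lemma self_mem_Orb: "p \<in> Orb p"
  using burau.orbit_refl by simp

text \<open>An inverse braid undoes the step, so later arguments may follow generators forwards and
  backwards.\<close>

lemma burau_act_mem_Orb_iff: "burau_act x q \<in> Orb p \<longleftrightarrow> q \<in> Orb p"
proof
  obtain y where y: "braid_mult y x = braid_one"
    using group.l_inv_ex[OF group_B4, of x] by (auto simp: B4_def)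
  assume "burau_act x q \<in> Orb p"
  then obtain z where "burau_act x q = burau_act z p" by (auto simp: orbit_def)
  then have "burau_act (braid_mult y x) q = burau_act (braid_mult y z) p"
    by (simp add: burau_act_mult)
  then show "q \<in> Orb p" by (auto simp: y burau_act_one orbit_def B4_def)
next
  assume "q \<in> Orb p"
  then show "burau_act x q \<in> Orb p"
    by (auto simp: orbit_def B4_def simp flip: burau_act_mult)
qed

text \<open>Induction on a word representing the braid. The equivalence in the first hypothesis is
  what handles inverse letters.\<close>

lemma Orb_subset:
  assumes "\<And>g q. burau_act (sigma g) q \<in> S \<longleftrightarrow> q \<in> S" and "p \<in> S"
  shows "Orb p \<subseteq> S"
proof -
  have "burau_act (abs_braid4 w) p \<in> S" for w
  proof (induction w)
    case Nil
    have "abs_braid4 [] = braid_one" by (simp add: braid_one_def)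
    then show ?case using assms(2) by (simp add: burau_act_one)
  next
    case (Cons a w)
    obtain g e where a: "a = (g, e)" by force
    have mult: "abs_braid4 (x # u) = braid_mult (abs_braid4 [x]) (abs_braid4 u)" for x u
      by (simp add: braid_mult.abs_eq)
    show ?case
    proof (cases e)
      case True
      then show ?thesis
        using Cons assms(1) by (simp add: a mult[of _ w] burau_act_mult flip: sigma.abs_eq)
    next
      case False
      have "braid_mult (sigma g) (abs_braid4 [(g, False)]) = braid_one"
        unfolding sigma.abs_eq braid_one_def
        using braid_eq.cancel[of g True] by (simp add: braid_mult.abs_eq braid4.abs_eq_iff)
      then have "burau_act (sigma g) (burau_act (abs_braid4 [(g, False)]) q) = q" for q
        by (simp add: burau_act_one flip: burau_act_mult)
      \<comment> \<open>\<open>sigma g\<close> cancels the leading inverse letter, so membership of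
        the image under \<open>w\<close> transfers to the image under \<open>a # w\<close>.\<close>
      then have "burau_act (sigma g) (burau_act (abs_braid4 (a # w)) p) = burau_act (abs_braid4 w) p"
        using False by (simp add: a mult[of _ w] burau_act_mult)
      then show ?thesis using Cons assms(1)[of g "burau_act (abs_braid4 (a # w)) p"] by simp
    qed
  qed
  then show ?thesis
    by (auto simp: orbit_def) (metis Quotient3_abs_rep Quotient3_braid4)
qed

section \<open>Invariance of the gcd and of the residue class\<close>

lemma burau_classE:
  assumes "q \<in> burau_class m n"
  obtains r s t where "q = hpoint r s t" "primitive r s t" "gcd (r - t) s = n \<and>
    (([r = m] (mod n) \<and> [t = m] (mod n)) \<or> ([r = - m] (mod n) \<and> [t = - m] (mod n)))"
  using assms unfolding burau_class_def primitive_def by auto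

text \<open>The only other primitive representative is the negated one, and negation preserves the
  gcd and exchanges the two signs. Membership can therefore be tested on whichever primitive
  representative is at hand.\<close>

lemma primitive_hpoint_in_burau_class_iff:
  assumes "primitive r s t"
  shows "hpoint r s t \<in> burau_class m n \<longleftrightarrow> gcd (r - t) s = n \<and>
    (([r = m] (mod n) \<and> [t = m] (mod n)) \<or> ([r = - m] (mod n) \<and> [t = - m] (mod n)))"
    (is "_ \<longleftrightarrow> ?C r s t")
proof
  have uminus: "?C (- r) (- s) (- t) \<longleftrightarrow> ?C r s t" for r s t
  proof -
    have "gcd (- r - - t) (- s) = gcd (r - t) s"
      using gcd_neg1_int[of "r - t" s] by (simp del: gcd_neg1_int)
    then show ?thesis
      using cong_minus_minus_iff[of r m n] cong_minus_minus_iff[of t m n]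
        cong_minus_minus_iff[of r "- m" n] cong_minus_minus_iff[of t "- m" n] by auto
  qed
  assume "hpoint r s t \<in> burau_class m n"
  then obtain r' s' t' where *: "hpoint r s t = hpoint r' s' t'" "primitive r' s' t'" "?C r' s' t'"
    by (rule burau_classE)
  from hpoint_primitive_eqD[OF *(1) assms *(2)]
  consider "r' = r" "s' = s" "t' = t" | "r' = - r" "s' = - s" "t' = - t"
    by blast
  then show "?C r s t"
  proof cases
    case 1
    show ?thesis using *(3) unfolding 1 .
  next
    case 2
    show ?thesis using *(3) unfolding 2 uminus .
  qed
next
  assume "?C r s t"
  then show "hpoint r s t \<in> burau_class m n"
    using assms unfolding burau_class_def primitive_def
    by (intro CollectI exI[of _ r] exI[of _ s] exI[of _ t]) simp
qed

text \<open>\<open>Sigma1\<close> and \<open>Sigma3\<close> change \<open>r\<close> or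
  \<open>t\<close> by \<open>s\<close>, a multiple of \<open>n\<close>, and so keep residues;
  \<open>Sigma2\<close> changes only \<open>s\<close>, by a multiple of \<open>r - t\<close>. Each
  is a shear on \<open>(r - t, s)\<close> and keeps the gcd.\<close>

lemma burau_act_sigma_in_burau_class_iff:
  "burau_act (sigma g) q \<in> burau_class m n \<longleftrightarrow> q \<in> burau_class m n"
proof -
  obtain r s t where prim: "primitive r s t" and q: "q = hpoint r s t"
    using ex_primitive_hpoint by blast
  note nz = primitive_nonzero[OF prim]
  show ?thesis
  proof (cases g)
    case Sigma1
    have "primitive (r + s) s t"
      using prim unfolding primitive_iff_common_dvd_unit by (auto simp: dvd_add_left_iff)
    moreover have "gcd (r + s - t) s = gcd (r - t) s"
      using gcd_add1[of "r - t" s] by (simp add: algebra_simps)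
    moreover have "[r + s = k] (mod n) \<longleftrightarrow> [r = k] (mod n)" if "n dvd s" for k
      using that dvd_add_left_iff[of n s "r - k"]
      by (simp add: cong_iff_dvd_diff algebra_simps)
    ultimately show ?thesis
      using prim by (auto simp: Sigma1 q burau_act_hpoint[OF nz] primitive_hpoint_in_burau_class_iff)
  next
    case Sigma2
    have "primitive r (s + t - r) t"
      using prim unfolding primitive_iff_common_dvd_unit by (auto simp: dvd_add_left_iff dvd_diff_left_iff)
    moreover have "gcd (r - t) (s + t - r) = gcd (r - t) s"
      using gcd_add_mult[of "r - t" "-1" s] by (simp add: algebra_simps)
    ultimately show ?thesis
      using prim by (auto simp: Sigma2 q burau_act_hpoint[OF nz] primitive_hpoint_in_burau_class_iff)
  next
    case Sigma3
    have "primitive r s (t - s)"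
      using prim unfolding primitive_iff_common_dvd_unit by (auto simp: dvd_diff_left_iff)
    moreover have "gcd (r - (t - s)) s = gcd (r - t) s"
      using gcd_add1[of "r - t" s] by (simp add: algebra_simps)
    moreover have "[t - s = k] (mod n) \<longleftrightarrow> [t = k] (mod n)" if "n dvd s" for k
      using that dvd_diff_left_iff[of n s "t - k"]
      by (simp add: cong_iff_dvd_diff algebra_simps)
    ultimately show ?thesis
      using prim by (auto simp: Sigma3 q burau_act_hpoint[OF nz] primitive_hpoint_in_burau_class_iff)
  qed
qed

section \<open>Euclidean reduction inside an orbit\<close>

text \<open>This is the subtractive Euclidean algorithm for integers of either sign, with |d| + |s|
  as the decreasing measure.\<close>

lemma shear_invariant_gcd:
  fixes P :: "int \<Rightarrow> int \<Rightarrow> bool"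
  assumes add: "\<And>d s. P (d + s) s \<longleftrightarrow> P d s"
    and diff: "\<And>d s. P d (s - d) \<longleftrightarrow> P d s"
  shows "P d s \<longleftrightarrow> P 0 (gcd d s)"
proof (induction "nat (\<bar>d\<bar> + \<bar>s\<bar>)" arbitrary: d s rule: less_induct)
  case less
  \<comment> \<open>The path is \<open>(d, 0)\<close>, \<open>(d, - d)\<close>,
    \<open>(0, - d)\<close>. Combined with \<open>(0, s)\<close>, \<open>(s, s)\<close>,
    \<open>(s, 0)\<close>, it flips the sign of the remaining entry.\<close>
  have swap: "P d 0 \<longleftrightarrow> P 0 (- d)" for d
    using diff[of d 0] add[of d "- d"] by simp
  have uminus: "P 0 (- s) \<longleftrightarrow> P 0 s" for s
    using add[of 0 s] diff[of s s] swap[of s] by simp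
  have abs: "P 0 \<bar>s\<bar> \<longleftrightarrow> P 0 s" for s
    using uminus[of s] by (simp add: abs_if)
  have sub: "P (d - s) s \<longleftrightarrow> P d s" "P d (s + d) \<longleftrightarrow> P d s" for d s
    using add[of "d - s" s] diff[of d "s + d"] by simp_all
  have gcds: "gcd (d + s) s = gcd d s" "gcd (d - s) s = gcd d s" "gcd d (s + d) = gcd d s"
      "gcd d (s - d) = gcd d s"
    by (simp_all only: gcd.commute[of d "s + d"] gcd.commute[of d "s - d"] gcd_add1 gcd_diff1
        gcd.commute[of s d])
  \<comment> \<open>For nonzero entries, an entry of larger or equal absolute value shrinks when the
    other is subtracted (equal signs) or added (opposite signs).\<close>
  consider "d = 0" | "s = 0" | "d \<noteq> 0" "s \<noteq> 0" "\<bar>d - s\<bar> < \<bar>d\<bar>" | "d \<noteq> 0" "s \<noteq> 0" "\<bar>d + s\<bar> < \<bar>d\<bar>"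
    | "d \<noteq> 0" "s \<noteq> 0" "\<bar>s - d\<bar> < \<bar>s\<bar>" | "d \<noteq> 0" "s \<noteq> 0" "\<bar>s + d\<bar> < \<bar>s\<bar>"
    by linarith
  then show ?case
  proof cases
    case 1
    then show ?thesis using abs[of s] by simp
  next
    case 2
    then show ?thesis using abs[of d] swap uminus by simp
  next
    case 3
    then have "P (d - s) s \<longleftrightarrow> P 0 (gcd (d - s) s)"
      by (intro less) linarith
    then show ?thesis by (simp only: sub gcds)
  next
    case 4
    then have "P (d + s) s \<longleftrightarrow> P 0 (gcd (d + s) s)"
      by (intro less) linarith
    then show ?thesis by (simp only: add gcds)
  next
    case 5
    then have "P d (s - d) \<longleftrightarrow> P 0 (gcd d (s - d))"
      by (intro less) linarith
    then show ?thesis by (simp only: diff gcds)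
  next
    case 6
    then have "P d (s + d) \<longleftrightarrow> P 0 (gcd d (s + d))"
      by (intro less) linarith
    then show ?thesis by (simp only: sub gcds)
  qed
qed

text \<open>For fixed \<open>t\<close>, \<open>Sigma1\<close> and \<open>Sigma2\<close> act on
  \<open>d = r - t\<close> and \<open>s\<close> exactly as the two shears of the Euclidean
  algorithm.\<close>

lemma hpoint_in_Orb_iff_gcd:
  assumes "(r, s, t) \<noteq> (0, 0, 0)"
  shows "hpoint r s t \<in> Orb p \<longleftrightarrow> hpoint t (gcd (r - t) s) t \<in> Orb p"
proof -
  \<comment> \<open>The zero triple names no point, so \<open>P\<close> is true there by convention;
    the shears map it to itself.\<close>
  define P where "P d s \<longleftrightarrow> (t + d, s, t) \<noteq> (0, 0, 0) \<longrightarrow> hpoint (t + d) s t \<in> Orb p" for d s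
  have "P (d + s) s \<longleftrightarrow> P d s" for d s
  proof (cases "(t + d, s, t) = (0, 0, 0)")
    case False
    then show ?thesis
      using burau_act_hpoint(1)[OF False] burau_act_mem_Orb_iff[of "sigma Sigma1" "hpoint (t + d) s t" p]
      by (auto simp: P_def add.assoc)
  qed (auto simp: P_def)
  moreover have "P d (s - d) \<longleftrightarrow> P d s" for d s
  proof (cases "(t + d, s, t) = (0, 0, 0)")
    case False
    then show ?thesis
      using burau_act_hpoint(2)[OF False] burau_act_mem_Orb_iff[of "sigma Sigma2" "hpoint (t + d) s t" p]
      by (auto simp: P_def)
  qed (auto simp: P_def)
  ultimately have "P (r - t) s \<longleftrightarrow> P 0 (gcd (r - t) s)"
    by (rule shear_invariant_gcd)
  then show ?thesis
    using assms by (auto simp: P_def)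
qed

text \<open>Both \<open>Sigma1\<close> applied to \<open>[m:n:m]\<close> and \<open>Sigma3\<close>
  applied to \<open>[m+n:n:m+n]\<close> give \<open>[m+n:n:m]\<close>; iterating in both directions
  reaches every integer \<open>k\<close>.\<close>

lemma hpoint_shift_in_Orb_iff:
  assumes "n \<noteq> 0"
  shows "hpoint (m + n * k) n (m + n * k) \<in> Orb p \<longleftrightarrow> hpoint m n m \<in> Orb p"
proof -
  have step: "hpoint (m + n) n (m + n) \<in> Orb p \<longleftrightarrow> hpoint m n m \<in> Orb p" for m
  proof -
    have "burau_act (sigma Sigma1) (hpoint m n m) = burau_act (sigma Sigma3) (hpoint (m + n) n (m + n))"
      using assms by (simp add: burau_act_hpoint)
    then show ?thesis by (metis burau_act_mem_Orb_iff)
  qed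
  show ?thesis
  proof (induction k rule: int_induct[of _ 0])
    case (step1 k)
    then show ?case using step[of "m + n * k"] by (simp add: algebra_simps)
  next
    case (step2 k)
    then show ?case using step[of "m + n * (k - 1)"] by (simp add: algebra_simps)
  qed simp
qed

section \<open>Identification and separation of the orbits\<close>

text \<open>One inclusion is invariance. For the other, Euclidean reduction leads to
  \<open>[t:n:t]\<close> and shifts by \<open>n\<close> lead on to \<open>[m:n:m]\<close>; the minus
  sign is removed by negating the representative.\<close>

lemma Orb_eq_burau_class:
  assumes "n \<ge> 1" "coprime m n"
  shows "Orb (hpoint m n m) = burau_class m n"
proof
  have "primitive m n m"
    using assms by (simp add: primitive_def gcd.commute[of n m])
  then have "hpoint m n m \<in> burau_class m n"
    using assms by (simp add: primitive_hpoint_in_burau_class_iff)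
  then show "Orb (hpoint m n m) \<subseteq> burau_class m n"
    by (intro Orb_subset burau_act_sigma_in_burau_class_iff)
  have *: "hpoint r s t \<in> Orb (hpoint m n m)"
    if prim: "primitive r s t" and gcd: "gcd (r - t) s = n" and cong: "[t = m] (mod n)" for r s t
  proof -
    obtain k where "t = m + n * k"
      using cong by (metis cong_iff_lin cong_sym)
    then show ?thesis
      using gcd assms hpoint_in_Orb_iff_gcd[OF primitive_nonzero[OF prim]] hpoint_shift_in_Orb_iff
        self_mem_Orb by simp
  qed
  show "burau_class m n \<subseteq> Orb (hpoint m n m)"
  proof
    fix q assume "q \<in> burau_class m n"
    then obtain r s t where q: "q = hpoint r s t" and prim: "primitive r s t"
      and gcd: "gcd (r - t) s = n" and t: "[t = m] (mod n) \<or> [t = - m] (mod n)"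
      by (elim burau_classE) auto
    from t show "q \<in> Orb (hpoint m n m)"
    proof
      assume "[t = m] (mod n)"
      then show ?thesis using * prim gcd q by simp
    next
      assume "[t = - m] (mod n)"
      then have "[- t = m] (mod n)"
        using cong_minus_minus_iff[of t "- m" n] by simp
      moreover have "primitive (- r) (- s) (- t)"
        using prim by (simp add: primitive_def)
      moreover have "gcd (- r - - t) (- s) = n"
        using gcd gcd_neg1_int[of "r - t" s] by (simp del: gcd_neg1_int)
      ultimately have "hpoint (- r) (- s) (- t) \<in> Orb (hpoint m n m)" by (rule *[rotated 2])
      then show ?thesis
        using q hpoint_uminus[OF primitive_nonzero[OF prim]] by simp
    qed
  qed
qed

text \<open>A common point forces equal gcds and makes \<open>n\<close> divide \<open>m - m'\<close>
  or \<open>m + m'\<close>. As both lie in the interval from 1 to \<open>n / 2\<close>, the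
  difference is below \<open>n\<close> in absolute value, and the sum reaches \<open>n\<close> only
  if \<open>m = m' = n / 2\<close>.\<close>

lemma burau_class_disjoint:
  assumes "(m, n) \<in> orbit_indices" "(m', n') \<in> orbit_indices"
    and "q \<in> burau_class m n" "q \<in> burau_class m' n'"
  shows "(m, n) = (m', n')"
proof -
  obtain r s t where prim: "primitive r s t" and q: "q = hpoint r s t"
    using ex_primitive_hpoint by blast
  have n: "n = n'" and dvd: "n dvd r - m \<or> n dvd r + m" "n dvd r - m' \<or> n dvd r + m'"
    using assms(3,4) by (auto simp: q primitive_hpoint_in_burau_class_iff[OF prim] cong_iff_dvd_diff)
  have "n dvd m - m' \<or> n dvd m + m'"
    using dvd dvd_diff[of n "r - m'" "r - m"] dvd_diff[of n "r + m'" "r - m"]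
      dvd_diff[of n "r + m" "r - m'"] dvd_diff[of n "r + m" "r + m'"]
    by (auto simp: add.commute)
  moreover have bounds: "0 < m" "2 * m \<le> n" "0 < m'" "2 * m' \<le> n"
    using assms(1,2) by (auto simp: orbit_indices_def n)
  ultimately have "m = m'"
  proof (elim disjE)
    assume "n dvd m - m'"
    then have "\<bar>n\<bar> \<le> \<bar>m - m'\<bar>" if "m \<noteq> m'"
      using that by (intro dvd_imp_le_int) auto
    then show ?thesis using bounds by linarith
  next
    assume "n dvd m + m'"
    then have "n \<le> m + m'" using bounds zdvd_imp_le by simp
    then show ?thesis using bounds by linarith
  qed
  then show ?thesis using n by simp
qed

theorem theorem1p1:
  shows "infinite (orbits B4 UNIV burau_act)
    \<and> Orb (hpoint 1 0 1) = {hpoint 1 0 1}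
    \<and> (UNIV :: proj_plane set) =
        {hpoint 1 0 1} \<union> Orb (hpoint 0 1 0) \<union> (\<Union>(m, n)\<in>orbit_indices. Orb (hpoint m n m))
    \<and> {hpoint 1 0 1} \<inter> Orb (hpoint 0 1 0) = {}
    \<and> {hpoint 1 0 1} \<inter> (\<Union>(m, n)\<in>orbit_indices. Orb (hpoint m n m)) = {}
    \<and> Orb (hpoint 0 1 0) \<inter> (\<Union>(m, n)\<in>orbit_indices. Orb (hpoint m n m)) = {}
    \<and> disjoint_family_on (\<lambda>(m, n). Orb (hpoint m n m)) orbit_indices
    \<and> inj_on (\<lambda>(m, n). Orb (hpoint m n m)) orbit_indices
    \<and> (\<forall>m n :: int. n \<ge> 1 \<longrightarrow> coprime m n \<longrightarrow>
        Orb (hpoint m n m) =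
          {hpoint r s t | r s t. gcd r (gcd s t) = 1 \<and> gcd (r - t) s = n \<and>
             (([r = m] (mod n) \<and> [t = m] (mod n)) \<or> ([r = - m] (mod n) \<and> [t = - m] (mod n)))})
    \<and> Orb (hpoint 0 1 0) =
        {hpoint r s t | r s t. gcd r (gcd s t) = 1 \<and> gcd (r - t) s = 1}"
proof (intro conjI allI impI)
  have Orb_mn: "Orb (hpoint m n m) = burau_class m n" if "(m, n) \<in> orbit_indices" for m n
    using that by (intro Orb_eq_burau_class) (auto simp: orbit_indices_def)
  \<comment> \<open>Modulo 1 the congruences are vacuous, so only the gcd condition remains.\<close>
  have Orb_010: "Orb (hpoint 0 1 0) = burau_class 0 1"
    by (rule Orb_eq_burau_class) simp_all
  \<comment> \<open>Here \<open>gcd (1 - 1) 0 = 0\<close>, which no class with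
    \<open>n \<ge> 1\<close> allows.\<close>
  have 101: "hpoint 1 0 1 \<notin> burau_class m n" if "n \<ge> 1" for m n
    using that by (subst primitive_hpoint_in_burau_class_iff) (auto simp: primitive_def)
  have classes_disjoint: "burau_class 0 1 \<inter> burau_class m n = {}" if "(m, n) \<in> orbit_indices" for m n
  proof -
    have "n \<noteq> 1"
      using that by (auto simp: orbit_indices_def)
    moreover have "n = 1" if "q \<in> burau_class 0 1" "q \<in> burau_class m n" for q
    proof -
      obtain r s t where "primitive r s t" "q = hpoint r s t"
        using ex_primitive_hpoint by blast
      then show ?thesis
        using that by (simp add: primitive_hpoint_in_burau_class_iff)
    qed
    ultimately show ?thesis by blast
  qed
  show disj: "disjoint_family_on (\<lambda>(m, n). Orb (hpoint m n m)) orbit_indices"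
    unfolding disjoint_family_on_def
  proof (intro ballI impI)
    fix i j :: "int \<times> int"
    assume *: "i \<in> orbit_indices" "j \<in> orbit_indices" "i \<noteq> j"
    obtain m n m' n' where ij: "i = (m, n)" "j = (m', n')" by force
    have "burau_class m n \<inter> burau_class m' n' = {}"
      using * burau_class_disjoint[of m n m' n'] unfolding ij by blast
    then show "(case i of (m, n) \<Rightarrow> Orb (hpoint m n m)) \<inter> (case j of (m, n) \<Rightarrow> Orb (hpoint m n m)) = {}"
      using * by (simp add: Orb_mn ij)
  qed
  show inj: "inj_on (\<lambda>(m, n). Orb (hpoint m n m)) orbit_indices"
  proof (rule inj_onI, clarify)
    fix m n m' n'
    assume *: "(m, n) \<in> orbit_indices" "(m', n') \<in> orbit_indices"
      and "Orb (hpoint m n m) = Orb (hpoint m' n' m')"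
    then have "hpoint m n m \<in> burau_class m n" "hpoint m n m \<in> burau_class m' n'"
      using self_mem_Orb[of "hpoint m n m"] by (simp_all add: Orb_mn)
    then have "(m, n) = (m', n')"
      using * burau_class_disjoint by blast
    then show "m = m' \<and> n = n'" by simp
  qed
  show "infinite (orbits B4 UNIV burau_act)"
  proof
    assume "finite (orbits B4 UNIV burau_act)"
    moreover have "(\<lambda>(m, n). Orb (hpoint m n m)) ` orbit_indices \<subseteq> orbits B4 UNIV burau_act"
      by (auto simp: orbits_def)
    ultimately have "finite orbit_indices"
      using inj finite_subset finite_imageD by blast
    \<comment> \<open>The pairs \<open>(1, n)\<close> with \<open>n \<ge> 2\<close> already give
      infinitely many distinct orbits.\<close>
    moreover have "Pair 1 ` {2..} \<subseteq> orbit_indices"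
      by (auto simp: orbit_indices_def)
    ultimately have "finite (Pair (1 :: int) ` {2 :: int..})"
      by (rule rev_finite_subset)
    then show False
      by (auto dest!: finite_imageD simp: inj_on_def infinite_Ici)
  qed
  show "Orb (hpoint 1 0 1) = {hpoint 1 0 1}"
  proof
    have fixed: "burau_act (sigma g) (hpoint 1 0 1) = hpoint 1 0 1" for g
      by (cases g) (simp_all add: burau_act_hpoint)
    have "inj (burau_act (sigma g))" for g
      using burau.inj_prop[of "sigma g"] by (simp add: B4_def)
    \<comment> \<open>Injectivity upgrades fixedness to the equivalence that
      \<open>Orb_subset\<close> requires.\<close>
    then have "burau_act (sigma g) q = hpoint 1 0 1 \<longleftrightarrow> q = hpoint 1 0 1" for g q
      using fixed by (metis injD)
    then show "Orb (hpoint 1 0 1) \<subseteq> {hpoint 1 0 1}"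
      by (intro Orb_subset) auto
  qed (simp add: self_mem_Orb)
  show "(UNIV :: proj_plane set) =
      {hpoint 1 0 1} \<union> Orb (hpoint 0 1 0) \<union> (\<Union>(m, n)\<in>orbit_indices. Orb (hpoint m n m))"
  proof (intro equalityI subsetI)
    fix q :: proj_plane
    obtain r s t where prim: "primitive r s t" and q: "q = hpoint r s t"
      using ex_primitive_hpoint by blast
    define n where "n = gcd (r - t) s"
    have rt: "[r = t] (mod n)"
      by (simp add: n_def cong_iff_dvd_diff)
    have "n \<ge> 0" by (simp add: n_def)
    \<comment> \<open>The three cases yield the fixed point, the orbit of \<open>[0:1:0]\<close> and
      an indexed orbit, respectively.\<close>
    then consider "n = 0" | "n = 1" | "n \<ge> 2" by linarith
    then show "q \<in> {hpoint 1 0 1} \<union> Orb (hpoint 0 1 0) \<union> (\<Union>(m, n)\<in>orbit_indices. Orb (hpoint m n m))"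
    proof cases
      case 1
      then have "r = t" "s = 0" by (simp_all add: n_def)
      then have "r = 1 \<or> r = - 1" "s = 0" "r = t"
        using prim by (auto simp: primitive_def)
      then have "q = hpoint 1 0 1"
        using q hpoint_uminus[of 1 0 1] by auto
      then show ?thesis by simp
    next
      case 2
      then show ?thesis
        using prim q by (simp add: Orb_010 primitive_hpoint_in_burau_class_iff n_def)
    next
      case 3
      have "n dvd s" "n dvd r - t" by (simp_all add: n_def)
      have "coprime t n"
      proof (rule coprimeI)
        fix d assume "d dvd t" "d dvd n"
        then have "d dvd s" "d dvd r"
          using \<open>n dvd s\<close> \<open>n dvd r - t\<close> by (metis dvd_trans dvd_diff_right_iff dvd_diff_left_iff)+
        then show "is_unit d"
          using prim \<open>d dvd t\<close> unfolding primitive_iff_common_dvd_unit by blast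
      qed
      define k where "k = t mod n"
      have k: "[t = k] (mod n)" by (simp add: k_def cong_def)
      then have cop: "coprime k n"
        using \<open>coprime t n\<close> cong_imp_coprime by blast
      have "0 \<le> k" "k < n"
        using 3 by (simp_all add: k_def)
      moreover have "k \<noteq> 0"
        using cop 3 by auto
      ultimately have bounds: "0 < k" "k < n" by simp_all
      \<comment> \<open>Either \<open>k\<close> or \<open>n - k\<close> lies in the lower half of
        the residues; replacing \<open>k\<close> by \<open>n - k\<close> is absorbed by the
        sign.\<close>
      have "\<exists>m. (m, n) \<in> orbit_indices \<and> ([t = m] (mod n) \<or> [t = - m] (mod n))"
      proof (cases "2 * k \<le> n")
        case True
        then show ?thesis
          using bounds cop 3 k by (auto simp: orbit_indices_def)
      next
        case False
        have "coprime (n - k) n"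
          using cop by (simp add: coprime_iff_gcd_eq_1 gcd_diff2)
        moreover have "[t = - (n - k)] (mod n)"
          using k by (simp add: cong_def)
        ultimately show ?thesis
          using False bounds 3 by (intro exI[of _ "n - k"]) (auto simp: orbit_indices_def)
      qed
      then obtain m where m: "(m, n) \<in> orbit_indices" "[t = m] (mod n) \<or> [t = - m] (mod n)"
        by blast
      then have "q \<in> burau_class m n"
        unfolding q primitive_hpoint_in_burau_class_iff[OF prim]
        by (auto simp flip: n_def intro: cong_trans[OF rt])
      then show ?thesis using m(1) Orb_mn by blast
    qed
  qed simp
  show "{hpoint 1 0 1} \<inter> Orb (hpoint 0 1 0) = {}"
    using 101 by (simp add: Orb_010)
  show "{hpoint 1 0 1} \<inter> (\<Union>(m, n)\<in>orbit_indices. Orb (hpoint m n m)) = {}"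
    using 101 by (auto simp: Orb_mn orbit_indices_def)
  show "Orb (hpoint 0 1 0) \<inter> (\<Union>(m, n)\<in>orbit_indices. Orb (hpoint m n m)) = {}"
    using classes_disjoint by (fastforce simp: Orb_mn Orb_010)
  show "Orb (hpoint 0 1 0) = {hpoint r s t | r s t. gcd r (gcd s t) = 1 \<and> gcd (r - t) s = 1}"
    by (simp add: Orb_010 burau_class_def)
  show "Orb (hpoint m n m) =
      {hpoint r s t | r s t. gcd r (gcd s t) = 1 \<and> gcd (r - t) s = n \<and>
         (([r = m] (mod n) \<and> [t = m] (mod n)) \<or> ([r = - m] (mod n) \<and> [t = - m] (mod n)))}"
    if "n \<ge> 1" "coprime m n" for m n :: int
    using Orb_eq_burau_class[OF that] by (simp add: burau_class_def)
qed

end
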